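(* Let $\mathscr R$ be the supertropical real $\nu$-semifield$^\dagger$ and $\Lambda=\{\lambda_1,\dots,\lambda_n\}$. Any intersection $\langle f\rangle=\bigcap_i K_i$ of (principal) $\nu$-subkernels $K_i$ of $\langle\mathscr R\rangle$ has an associated wedge decomposition; that is, there is an expression $|f|=\bigwedge_i|u_i|$ with $u_i\in\mathscr R(\Lambda)$ and $K_i=\langle u_i\rangle$ for each $i$.
   Context: **Supertropical reals.** $\mathscr R=\mathcal T\sqcup\mathcal G$, where $\mathcal T$ is the ordered group $(\mathbb R,+)$ written multiplicatively (unit $1$) and $\mathcal G$ is a second (ghost) copy; $\nu:\mathscr R\to\mathcal G$, $a\mapsto a^\nu$, is the identity on $\mathcal G$ and the identification on $\mathcal T$; $ab^\nu=a^\nu b=a^\nu b^\nu=(ab)^\nu$; and $a+b$ is whichever of $a,b$ has larger $\nu$-value, or $a^\nu$ if $a^\nu=b^\nu$. Write $a\cong_\nu b$ if $a^\nu=b^\nu$ and $a\ge_\nu b$ if $a^\nu\ge b^\nu$. For $a\in\mathcal T$ put $a^*=a^{-1}$, $(a^\nu)^*=(a^{-1})^\nu$; for any $a,b\in\mathscr R$ put $|a|=a+a^*$ and $a\wedge b=(a^*+b^* )^*$ (up to $\cong_\nu$ this is the minimum); $\bigwedge_i$ denotes the corresponding infimum over a family. These are applied to functions pointwise; identities between rational functions are understood up to $\cong_\nu$. **Rational functions.** $\mathscr R(\Lambda)$ consists of the functions $\mathscr R^{(n)}\to\mathscr R$ of the form $\mathbf a\mapsto h(\mathbf a)g(\mathbf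 a)^*$ with $h$ a polynomial over $\mathscr R$ and $g$ a polynomial with tangible coefficients (coefficients in $\mathcal T$), with pointwise operations. **Kernels.** A $\nu$-kernel of $\mathscr R(\Lambda)$ is a subgroup $K$ (closed under products and $*$) such that $a,b\in K$ and $\alpha,\beta\in\mathscr R(\Lambda)$ with $\alpha+\beta\cong_\nu1$ imply $\alpha a+\beta b\in K$; these are handled up to $\cong_\nu$. $\langle S\rangle$ is the $\nu$-kernel generated by $S$, and $\langle f\rangle=\langle\{f\}\rangle$; principal means generated by one element; $\langle\mathscr R\rangle$ is the $\nu$-kernel generated by the constants. A $\nu$-subkernel of $\langle\mathscr R\rangle$ is a $\nu$-kernel contained in $\langle\mathscr R\rangle$. **Wedge decomposition.** A wedge decomposition of a rational function $f$ is an expression $|f|=\bigwedge_i|u_i|$ with the $u_i$ rational functions; it is associated to an intersection $\langle f\rangle=\bigcap_i K_i$ of $\nu$-kernels if $K_i=\langle u_i\rangle$ for each $i$. *)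

theory Defs
  imports Complex_Main "HOL-Library.Function_Algebras"
begin

text \<open>
  The supertropical reals: two copies of the additive group of the reals, written
  multiplicatively.  There is no zero element (no bottom), so sums are always over nonempty
  families, and the unit is \<open>Tangible 0\<close>.
\<close>

datatype strop = Tangible real | Ghost real

primrec nuval :: "strop \<Rightarrow> real" where
  "nuval (Tangible r) = r"
| "nuval (Ghost r) = r"

definition nu :: "strop \<Rightarrow> strop" where
  "nu a = Ghost (nuval a)"

definition tangible :: "strop set" where
  "tangible = range Tangible"

definition nu_eq :: "strop \<Rightarrow> strop \<Rightarrow> bool" (infix "\<cong>\<^sub>\<nu>" 50) where
  "a \<cong>\<^sub>\<nu> b \<longleftrightarrow> nu a = nu b"

definition nu_le :: "strop \<Rightarrow> strop \<Rightarrow> bool" (infix "\<le>\<^sub>\<nu>" 50) where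
  "a \<le>\<^sub>\<nu> b \<longleftrightarrow> nuval a \<le> nuval b"

instantiation strop :: "{comm_semiring, comm_monoid_mult}"
begin

definition one_strop :: strop where
  "1 = Tangible 0"

fun times_strop :: "strop \<Rightarrow> strop \<Rightarrow> strop" where
  "Tangible r * Tangible s = Tangible (r + s)"
| "Tangible r * Ghost s = Ghost (r + s)"
| "Ghost r * Tangible s = Ghost (r + s)"
| "Ghost r * Ghost s = Ghost (r + s)"

definition plus_strop :: "strop \<Rightarrow> strop \<Rightarrow> strop" where
  "a + b = (if nuval b < nuval a then a else if nuval a < nuval b then b else nu a)"

instance
proof
  fix a b c :: strop
  show "a + b + c = a + (b + c)"
    by (cases a; cases b; cases c) (auto simp: plus_strop_def nu_def)
  show "a + b = b + a"
    by (cases a; cases b) (auto simp: plus_strop_def nu_def)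
  show "a * b * c = a * (b * c)"
    by (cases a; cases b; cases c) auto
  show "a * b = b * a"
    by (cases a; cases b) auto
  show "1 * a = a"
    by (cases a) (auto simp: one_strop_def)
  show "(a + b) * c = a * c + b * c"
    by (cases a; cases b; cases c) (auto simp: plus_strop_def nu_def)
qed

end

primrec star :: "strop \<Rightarrow> strop" where
  "star (Tangible r) = Tangible (- r)"
| "star (Ghost r) = Ghost (- r)"

definition sabs :: "strop \<Rightarrow> strop" where
  "sabs a = a + star a"

definition wedge :: "strop \<Rightarrow> strop \<Rightarrow> strop" (infixr "\<and>\<^sub>\<nu>" 65) where
  "a \<and>\<^sub>\<nu> b = star (star a + star b)"

text \<open>
  \<open>is_wedge w I a\<close>: up to \<open>\<cong>\<^sub>\<nu>\<close>, the element \<open>w\<close> is the infimum of the (possibly infinite)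
  family \<open>(a i)\<close>, \<open>i \<in> I\<close>.  The lemmas below show that on finite nonempty families this is
  the iterated \<open>\<and>\<^sub>\<nu>\<close>.
\<close>

definition is_wedge :: "strop \<Rightarrow> 'i set \<Rightarrow> ('i \<Rightarrow> strop) \<Rightarrow> bool" where
  "is_wedge w I a \<longleftrightarrow>
     (\<forall>i\<in>I. w \<le>\<^sub>\<nu> a i) \<and> (\<forall>b. (\<forall>i\<in>I. b \<le>\<^sub>\<nu> a i) \<longrightarrow> b \<le>\<^sub>\<nu> w)"

lemma is_wedge_singleton: "is_wedge w {i} a \<longleftrightarrow> w \<cong>\<^sub>\<nu> a i"
  by (auto simp: is_wedge_def nu_le_def nu_eq_def nu_def intro: antisym)

lemma nuval_star [simp]: "nuval (star a) = - nuval a"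
  by (cases a) auto

lemma nuval_wedge: "nuval (a \<and>\<^sub>\<nu> b) = min (nuval a) (nuval b)"
  by (auto simp: wedge_def plus_strop_def nu_def)

lemma is_wedge_insert:
  assumes "is_wedge w I a"
  shows "is_wedge (a j \<and>\<^sub>\<nu> w) (insert j I) a"
  using assms by (auto simp: is_wedge_def nu_le_def nuval_wedge min.coboundedI2)

text \<open>
  A polynomial is a nonempty list of terms (coefficient, exponent vector) with pairwise
  distinct exponent vectors.  Distinctness matters for the notion of tangible coefficients,
  since the sum of two equal tangible terms is ghost.
\<close>

type_synonym 'n term_ = "strop \<times> ('n \<Rightarrow> nat)"

definition is_poly :: "strop set \<Rightarrow> 'n term_ list \<Rightarrow> bool" where
  "is_poly C p \<longleftrightarrow> p \<noteq> [] \<and> distinct (map snd p) \<and> fst ` set p \<subseteq> C"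

definition term_eval :: "'n::finite term_ \<Rightarrow> ('n \<Rightarrow> strop) \<Rightarrow> strop" where
  "term_eval t x = fst t * (\<Prod>i\<in>UNIV. x i ^ snd t i)"

definition poly_eval :: "'n::finite term_ list \<Rightarrow> ('n \<Rightarrow> strop) \<Rightarrow> strop" where
  "poly_eval p x = foldl (\<lambda>s t. s + term_eval t x) (term_eval (hd p) x) (tl p)"

type_synonym 'n sfun = "('n \<Rightarrow> strop) \<Rightarrow> strop"

definition rational_funs :: "'n::finite sfun set" where
  "rational_funs =
     {\<lambda>x. poly_eval h x * star (poly_eval g x) | h g. is_poly UNIV h \<and> is_poly tangible g}"

definition fun_nu_eq :: "'n sfun \<Rightarrow> 'n sfun \<Rightarrow> bool" (infix "\<approx>\<^sub>\<nu>" 50) where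
  "f \<approx>\<^sub>\<nu> g \<longleftrightarrow> (\<forall>x. f x \<cong>\<^sub>\<nu> g x)"

text \<open>
  The set \<open>rational_funs\<close> is closed under sums and \<open>star\<close> only up to \<open>\<approx>\<^sub>\<nu>\<close>.  Each closure
  condition of a \<open>\<nu>\<close>-kernel is therefore imposed on all rational functions that are
  \<open>\<nu>\<close>-equivalent to the element in question.  In particular a \<open>\<nu>\<close>-kernel is a union of
  \<open>\<nu>\<close>-classes of rational functions (take \<open>\<alpha> = \<beta> = 1\<close> and \<open>a = b\<close>), so equality of
  \<open>\<nu>\<close>-kernels as sets is equality up to \<open>\<approx>\<^sub>\<nu>\<close>.
\<close>

definition nu_kernel :: "'n::finite sfun set \<Rightarrow> bool" where
  "nu_kernel K \<longleftrightarrow> K \<subseteq> rational_funs \<and> K \<noteq> {} \<and>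
     (\<forall>a\<in>K. \<forall>b\<in>K. \<forall>c\<in>rational_funs. c \<approx>\<^sub>\<nu> a * b \<longrightarrow> c \<in> K) \<and>
     (\<forall>a\<in>K. \<forall>c\<in>rational_funs. c \<approx>\<^sub>\<nu> star \<circ> a \<longrightarrow> c \<in> K) \<and>
     (\<forall>a\<in>K. \<forall>b\<in>K. \<forall>\<alpha>\<in>rational_funs. \<forall>\<beta>\<in>rational_funs. \<forall>c\<in>rational_funs.
        \<alpha> + \<beta> \<approx>\<^sub>\<nu> 1 \<longrightarrow> c \<approx>\<^sub>\<nu> \<alpha> * a + \<beta> * b \<longrightarrow> c \<in> K)"

definition kernel_gen :: "'n::finite sfun set \<Rightarrow> 'n sfun set" where
  "kernel_gen S = nu_kernel hull S"

definition principal_kernel :: "'n::finite sfun set \<Rightarrow> bool" where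
  "principal_kernel K \<longleftrightarrow> (\<exists>u\<in>rational_funs. K = kernel_gen {u})"

definition const_kernel :: "'n::finite sfun set" where
  "const_kernel = kernel_gen (range (\<lambda>c x. c))"

definition nu_subkernel :: "'n::finite sfun set \<Rightarrow> 'n sfun set \<Rightarrow> bool" where
  "nu_subkernel K L \<longleftrightarrow> nu_kernel K \<and> K \<subseteq> L"

definition wedge_decomposition :: "'n::finite sfun \<Rightarrow> 'i set \<Rightarrow> ('i \<Rightarrow> 'n sfun) \<Rightarrow> bool" where
  "wedge_decomposition f I u \<longleftrightarrow>
     (\<forall>i\<in>I. u i \<in> rational_funs) \<and> (\<forall>x. is_wedge (sabs (f x)) I (\<lambda>i. sabs (u i x)))"

definition associated_decomposition ::
    "'i set \<Rightarrow> ('i \<Rightarrow> 'n::finite sfun set) \<Rightarrow> ('i \<Rightarrow> 'n sfun) \<Rightarrow> bool" where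
  "associated_decomposition I K u \<longleftrightarrow> (\<forall>i\<in>I. K i = kernel_gen {u i})"

end

(* Up to \<nu>-equivalence a rational function is a difference of two tropical polynomials, these
   differences form a lattice-ordered group, and \<langle>f\<rangle> consists of the g with |g| \<le> m|f| for some m.
   Let K_i = \<langle>v_i\<rangle>.  Suppose that generators w_i \<ge> 0 of the K_i satisfy inf_i w_i \<le> m|f| pointwise.
   Then u_i = |f| + max(0, w_i - m|f|) generates K_i, since f lies in K_i and w_i \<le> m|f| + u_i,
   and inf_i u_i = |f|.
   If I is finite, take w_i = |v_i|: the minimum of the w_i lies in every K_i, hence in \<langle>f\<rangle>.
   If I is infinite, take w_i = min(|v_i|, e_i) with constants e_i > 0 of infimum 0; since K_i lies in
   \<langle>R\<rangle>, v_i is bounded, so w_i still generates K_i. *)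

theory Submission
  imports Defs
begin

section \<open>Real values of the supertropical operations\<close>

lemma nuval_times [simp]: "nuval (a * b) = nuval a + nuval b"
  by (cases a; cases b) auto

lemma nuval_plus [simp]: "nuval (a + b) = max (nuval a) (nuval b)"
  by (auto simp: plus_strop_def nu_def)

lemma nuval_one [simp]: "nuval 1 = 0"
  by (simp add: one_strop_def)

lemma nuval_power [simp]: "nuval (a ^ k) = real k * nuval a"
  by (induction k) (auto simp: algebra_simps)

lemma nuval_prod: "nuval (\<Prod>i\<in>A. g i) = (\<Sum>i\<in>A. nuval (g i))"
  by (induction A rule: infinite_finite_induct) auto

lemma nuval_sabs [simp]: "nuval (sabs a) = \<bar>nuval a\<bar>"
  by (auto simp: sabs_def)

lemma nu_eq_iff: "a \<cong>\<^sub>\<nu> b \<longleftrightarrow> nuval a = nuval b"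
  by (simp add: nu_eq_def nu_def)

lemma fun_nu_eq_iff: "f \<approx>\<^sub>\<nu> g \<longleftrightarrow> nuval \<circ> f = nuval \<circ> g"
  by (auto simp: fun_nu_eq_def nu_eq_iff fun_eq_iff)

section \<open>Values of polynomials and rational functions\<close>

definition affine_val :: "real \<times> ('n \<Rightarrow> nat) \<Rightarrow> ('n::finite \<Rightarrow> strop) \<Rightarrow> real" where
  "affine_val t x = fst t + (\<Sum>i\<in>UNIV. real (snd t i) * nuval (x i))"

text \<open>Terms with equal exponent vectors are allowed here, in contrast to
  \<open>is_poly\<close>. Maxima and sums then only require a union or a sumset of the term sets,
  and repetitions are removed once, in \<open>trop_polys_poly\<close>.\<close>

definition trop_polys :: "(('n::finite \<Rightarrow> strop) \<Rightarrow> real) set" where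
  "trop_polys = {\<lambda>x. Max ((\<lambda>t. affine_val t x) ` S) | S. finite S \<and> S \<noteq> {}}"

definition trop_rats :: "(('n::finite \<Rightarrow> strop) \<Rightarrow> real) set" where
  "trop_rats = {\<lambda>x. P x - Q x | P Q. P \<in> trop_polys \<and> Q \<in> trop_polys}"

lemma trop_ratsI:
  "P \<in> trop_polys \<Longrightarrow> Q \<in> trop_polys \<Longrightarrow> F = (\<lambda>x. P x - Q x) \<Longrightarrow> F \<in> trop_rats"
  unfolding trop_rats_def by blast

lemma nuval_term_eval: "nuval (term_eval t x) = affine_val (nuval (fst t), snd t) x"
  by (simp add: term_eval_def affine_val_def nuval_prod)

text \<open>The start value \<open>a\<close> is arbitrary because \<open>poly_eval\<close> folds
  from its first term: there is no zero element to start from.\<close>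

lemma nuval_foldl:
  "nuval (foldl (\<lambda>s t. s + g t) a l) = Max (insert (nuval a) ((\<lambda>t. nuval (g t)) ` set l))"
proof (induction l arbitrary: a)
  case (Cons t l)
  show ?case
    by (cases "l = []") (simp_all add: Cons.IH Max_insert max.assoc max.left_commute)
qed simp

lemma nuval_poly_eval:
  assumes "p \<noteq> []"
  shows "nuval (poly_eval p x) = Max ((\<lambda>t. nuval (term_eval t x)) ` set p)"
  using assms by (cases p) (simp_all add: poly_eval_def nuval_foldl)

lemma poly_in_trop_polys:
  assumes "is_poly C p"
  shows "nuval \<circ> poly_eval p \<in> trop_polys"
proof -
  have "p \<noteq> []" using assms by (simp add: is_poly_def)
  let ?S = "(\<lambda>t. (nuval (fst t), snd t)) ` set p"
  have "nuval \<circ> poly_eval p = (\<lambda>x. Max ((\<lambda>t. affine_val t x) ` ?S))"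
    using \<open>p \<noteq> []\<close> by (simp add: fun_eq_iff nuval_poly_eval nuval_term_eval image_image)
  then show ?thesis
    unfolding trop_polys_def using \<open>p \<noteq> []\<close> by blast
qed

text \<open>Exponent vectors must be distinct, so among terms with equal exponents only the
  largest coefficient is kept.\<close>

lemma trop_polys_poly:
  assumes "P \<in> trop_polys"
  obtains p where "is_poly tangible p" "nuval \<circ> poly_eval p = P"
proof -
  obtain S where S: "finite S" "S \<noteq> {}" and P: "P = (\<lambda>x. Max ((\<lambda>t. affine_val t x) ` S))"
    using assms by (auto simp: trop_polys_def)
  \<comment> \<open>For an exponent vector that does not occur in \<open>S\<close> this is the
    maximum of an empty set, hence unspecified; \<open>p\<close> ranges only over those that
    occur.\<close>
  define c where "c k = Max {r. (r, k) \<in> S}" for k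
  have fin: "finite {r. (r, k) \<in> S}" for k
    by (rule finite_subset[of _ "fst ` S"]) (use S in force)+
  have c_in: "(c k, k) \<in> S" if "k \<in> snd ` S" for k
  proof -
    have "{r. (r, k) \<in> S} \<noteq> {}" using that by auto
    from Max_in[OF fin this] show ?thesis by (simp add: c_def)
  qed
  have c_ge: "r \<le> c k" if "(r, k) \<in> S" for r k
    unfolding c_def using fin that by (intro Max_ge) auto
  obtain ks where ks: "set ks = snd ` S" "distinct ks"
    using finite_distinct_list[of "snd ` S"] S by auto
  define p where "p = map (\<lambda>k. (Tangible (c k), k)) ks"
  have p_ne: "p \<noteq> []" using ks S by (auto simp: p_def)
  have "is_poly tangible p"
    using p_ne ks by (auto simp: is_poly_def p_def tangible_def comp_def)
  moreover have "nuval (poly_eval p x) = P x" for x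
  proof -
    have eq: "nuval (poly_eval p x) = Max ((\<lambda>k. affine_val (c k, k) x) ` snd ` S)"
      unfolding ks(1)[symmetric] using p_ne
      by (simp add: nuval_poly_eval nuval_term_eval p_def image_image)
    show ?thesis unfolding eq P
    proof (rule antisym)
      show "Max ((\<lambda>k. affine_val (c k, k) x) ` snd ` S) \<le> Max ((\<lambda>t. affine_val t x) ` S)"
        using S c_in by (intro Max.boundedI Max_ge) auto
      have "affine_val t x \<le> Max ((\<lambda>k. affine_val (c k, k) x) ` snd ` S)" if "t \<in> S" for t
      proof -
        have "affine_val t x \<le> affine_val (c (snd t), snd t) x"
          using c_ge[of "fst t" "snd t"] that by (simp add: affine_val_def)
        also have "\<dots> \<le> Max ((\<lambda>k. affine_val (c k, k) x) ` snd ` S)"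
          using S that by (intro Max_ge) auto
        finally show ?thesis .
      qed
      then show "Max ((\<lambda>t. affine_val t x) ` S) \<le> Max ((\<lambda>k. affine_val (c k, k) x) ` snd ` S)"
        using S by (intro Max.boundedI) auto
    qed
  qed
  ultimately show ?thesis using that by (auto simp: fun_eq_iff)
qed

lemma trop_polys_max:
  assumes "P \<in> trop_polys" "Q \<in> trop_polys"
  shows "(\<lambda>x. max (P x) (Q x)) \<in> trop_polys"
proof -
  obtain S T where S: "finite S" "S \<noteq> {}" "P = (\<lambda>x. Max ((\<lambda>t. affine_val t x) ` S))"
    and T: "finite T" "T \<noteq> {}" "Q = (\<lambda>x. Max ((\<lambda>t. affine_val t x) ` T))"
    using assms by (auto simp: trop_polys_def)
  have "(\<lambda>x. max (P x) (Q x)) = (\<lambda>x. Max ((\<lambda>t. affine_val t x) ` (S \<union> T)))"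
    using S T by (simp add: image_Un Max_Un)
  then show ?thesis unfolding trop_polys_def using S T by blast
qed

text \<open>This is multiplication of polynomials: every term of one is multiplied by every term of
  the other. At a given point the product of two maximal terms attains the sum of the
  maxima.\<close>

lemma trop_polys_add:
  assumes "P \<in> trop_polys" "Q \<in> trop_polys"
  shows "(\<lambda>x. P x + Q x) \<in> trop_polys"
proof -
  obtain S T where S: "finite S" "S \<noteq> {}" "P = (\<lambda>x. Max ((\<lambda>t. affine_val t x) ` S))"
    and T: "finite T" "T \<noteq> {}" "Q = (\<lambda>x. Max ((\<lambda>t. affine_val t x) ` T))"
    using assms by (auto simp: trop_polys_def)
  define g :: "(real \<times> ('a \<Rightarrow> nat)) \<times> (real \<times> ('a \<Rightarrow> nat)) \<Rightarrow> _"
    where "g = (\<lambda>(s, t). (fst s + fst t, \<lambda>i. snd s i + snd t i))"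
  have g: "affine_val (g (s, t)) x = affine_val s x + affine_val t x" for s t x
    by (simp add: g_def affine_val_def sum.distrib algebra_simps)
  have "P x + Q x = Max ((\<lambda>t. affine_val t x) ` g ` (S \<times> T))" for x
  proof (rule sym, rule Max_eqI)
    show "finite ((\<lambda>t. affine_val t x) ` g ` (S \<times> T))" using S T by auto
    show "y \<le> P x + Q x" if "y \<in> (\<lambda>t. affine_val t x) ` g ` (S \<times> T)" for y
    proof -
      obtain s t where "s \<in> S" "t \<in> T" "y = affine_val s x + affine_val t x"
        using \<open>y \<in> _\<close> g by auto
      then show ?thesis using S T by (auto intro!: add_mono Max_ge)
    qed
    have "P x \<in> (\<lambda>t. affine_val t x) ` S" "Q x \<in> (\<lambda>t. affine_val t x) ` T"
      using S T by (auto intro!: Max_in)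
    then obtain s t where "s \<in> S" "t \<in> T" "P x + Q x = affine_val s x + affine_val t x"
      by auto
    then show "P x + Q x \<in> (\<lambda>t. affine_val t x) ` g ` (S \<times> T)"
      by (intro image_eqI[where x = "g (s, t)"] image_eqI[where x = "(s, t)"]) (auto simp: g)
  qed
  moreover have "finite (g ` (S \<times> T))" "g ` (S \<times> T) \<noteq> {}"
    using S T by auto
  ultimately show ?thesis unfolding trop_polys_def by blast
qed

text \<open>All notions in the theorem depend on functions only up to nu-equivalence, that is, on
  their values, so rational functions can be treated as real functions from here on. Requiring
  tangible denominators costs nothing, because every tropical polynomial is the value of a
  polynomial with tangible coefficients.\<close>

lemma nuval_image_rational_funs: "(\<lambda>r. nuval \<circ> r) ` rational_funs = trop_rats"
proof (intro equalityI subsetI)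
  fix F :: "('a \<Rightarrow> strop) \<Rightarrow> real" assume "F \<in> (\<lambda>r. nuval \<circ> r) ` rational_funs"
  then obtain h g where hg: "is_poly UNIV h" "is_poly tangible g"
    and F: "F = nuval \<circ> (\<lambda>x. poly_eval h x * star (poly_eval g x))"
    by (auto simp: rational_funs_def)
  have "F = (\<lambda>x. (nuval \<circ> poly_eval h) x - (nuval \<circ> poly_eval g) x)"
    by (simp add: F fun_eq_iff)
  then show "F \<in> trop_rats"
    unfolding trop_rats_def using hg[THEN poly_in_trop_polys] by blast
next
  fix F :: "('a \<Rightarrow> strop) \<Rightarrow> real" assume "F \<in> trop_rats"
  then obtain P Q where PQ: "P \<in> trop_polys" "Q \<in> trop_polys" and F: "F = (\<lambda>x. P x - Q x)"
    by (auto simp: trop_rats_def)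
  obtain h g where h: "is_poly tangible h" "nuval \<circ> poly_eval h = P"
    and g: "is_poly tangible g" "nuval \<circ> poly_eval g = Q"
    using PQ trop_polys_poly by metis
  have "is_poly UNIV h" using h by (simp add: is_poly_def)
  then have "(\<lambda>x. poly_eval h x * star (poly_eval g x)) \<in> rational_funs"
    unfolding rational_funs_def using g by blast
  moreover have "nuval \<circ> (\<lambda>x. poly_eval h x * star (poly_eval g x)) = F"
    using h g F by (auto simp: fun_eq_iff)
  ultimately show "F \<in> (\<lambda>r. nuval \<circ> r) ` rational_funs" by blast
qed

lemma rational_trop: "r \<in> rational_funs \<Longrightarrow> (\<lambda>x. nuval (r x)) \<in> trop_rats"
  using imageI[of r rational_funs "\<lambda>r. nuval \<circ> r", unfolded nuval_image_rational_funs]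
  by (simp add: comp_def)

lemma trop_rational:
  assumes "F \<in> trop_rats"
  obtains r where "r \<in> rational_funs" "\<And>x. nuval (r x) = F x"
proof -
  have "F \<in> (\<lambda>r. nuval \<circ> r) ` rational_funs"
    using assms by (simp only: nuval_image_rational_funs)
  then obtain r where r: "r \<in> rational_funs" "F = nuval \<circ> r" by blast
  show ?thesis by (rule that[OF r(1)]) (simp add: r(2))
qed

text \<open>Choice lifts real formulas to rational functions simultaneously over an arbitrary,
  possibly infinite, index set.\<close>

lemma trop_rational_family:
  assumes "\<And>i. i \<in> I \<Longrightarrow> F i \<in> trop_rats"
  obtains r where "\<And>i. i \<in> I \<Longrightarrow> r i \<in> rational_funs"
    "\<And>i x. i \<in> I \<Longrightarrow> nuval (r i x) = F i x"
proof -
  have "\<forall>i\<in>I. \<exists>r. r \<in> rational_funs \<and> (\<forall>x. nuval (r x) = F i x)"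
  proof
    fix i assume "i \<in> I"
    from trop_rational[OF assms[OF this]]
    show "\<exists>r. r \<in> rational_funs \<and> (\<forall>x. nuval (r x) = F i x)" by metis
  qed
  from bchoice[OF this] show ?thesis using that by blast
qed

lemma const_rational: "(\<lambda>x. c) \<in> rational_funs"
proof -
  have "(\<lambda>x. c) = (\<lambda>x::'a \<Rightarrow> strop.
      poly_eval [(c, \<lambda>i. 0)] x * star (poly_eval [(Tangible 0, \<lambda>i. 0)] x))"
    by (cases c) (simp_all add: fun_eq_iff poly_eval_def term_eval_def)
  moreover have "is_poly UNIV [(c, \<lambda>i::'a. 0)]" "is_poly tangible [(Tangible 0, \<lambda>i::'a. 0)]"
    by (auto simp: is_poly_def tangible_def)
  ultimately show ?thesis unfolding rational_funs_def by blast
qed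

section \<open>The lattice-ordered group of differences of tropical polynomials\<close>

lemma trop_rats_const: "(\<lambda>x. r) \<in> trop_rats"
  using rational_trop[OF const_rational[of "Tangible r"]] by simp

lemma trop_rats_uminus:
  assumes "F \<in> trop_rats"
  shows "(\<lambda>x. - F x) \<in> trop_rats"
proof -
  obtain P Q where "P \<in> trop_polys" "Q \<in> trop_polys" "F = (\<lambda>x. P x - Q x)"
    using assms unfolding trop_rats_def by blast
  then show ?thesis by (intro trop_ratsI[of Q P]) auto
qed

lemma trop_rats_add:
  assumes "F \<in> trop_rats" "G \<in> trop_rats"
  shows "(\<lambda>x. F x + G x) \<in> trop_rats"
proof -
  obtain P Q P' Q' where "P \<in> trop_polys" "Q \<in> trop_polys" "P' \<in> trop_polys" "Q' \<in> trop_polys"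
    and FG: "F = (\<lambda>x. P x - Q x)" "G = (\<lambda>x. P' x - Q' x)"
    using assms by (auto simp: trop_rats_def)
  then have "(\<lambda>x. P x + P' x) \<in> trop_polys" "(\<lambda>x. Q x + Q' x) \<in> trop_polys"
    by (auto intro: trop_polys_add)
  moreover have "(\<lambda>x. F x + G x) = (\<lambda>x. (P x + P' x) - (Q x + Q' x))"
    by (auto simp: FG)
  ultimately show ?thesis by (rule trop_ratsI)
qed

text \<open>Bring both differences to the common denominator \<open>Q + Q'\<close>; subtracting it
  commutes with the maximum.\<close>

lemma trop_rats_max:
  assumes "F \<in> trop_rats" "G \<in> trop_rats"
  shows "(\<lambda>x. max (F x) (G x)) \<in> trop_rats"
proof -
  obtain P Q P' Q' where "P \<in> trop_polys" "Q \<in> trop_polys" "P' \<in> trop_polys" "Q' \<in> trop_polys"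
    and FG: "F = (\<lambda>x. P x - Q x)" "G = (\<lambda>x. P' x - Q' x)"
    using assms by (auto simp: trop_rats_def)
  then have "(\<lambda>x. max (P x + Q' x) (P' x + Q x)) \<in> trop_polys" "(\<lambda>x. Q x + Q' x) \<in> trop_polys"
    by (auto intro: trop_polys_add trop_polys_max)
  moreover have "(\<lambda>x. max (F x) (G x)) = (\<lambda>x. max (P x + Q' x) (P' x + Q x) - (Q x + Q' x))"
    by (auto simp: FG fun_eq_iff max_def)
  ultimately show ?thesis by (rule trop_ratsI)
qed

lemma trop_rats_diff:
  assumes "F \<in> trop_rats" "G \<in> trop_rats"
  shows "(\<lambda>x. F x - G x) \<in> trop_rats"
  using trop_rats_add[OF assms(1) trop_rats_uminus[OF assms(2)]] by simp

lemma trop_rats_min: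
  assumes "F \<in> trop_rats" "G \<in> trop_rats"
  shows "(\<lambda>x. min (F x) (G x)) \<in> trop_rats"
proof -
  have "(\<lambda>x. min (F x) (G x)) = (\<lambda>x. - max (- F x) (- G x))"
    by (auto simp: fun_eq_iff max_def min_def)
  then show ?thesis
    using trop_rats_uminus[OF trop_rats_max[OF assms[THEN trop_rats_uminus]]] by simp
qed

lemma trop_rats_abs:
  assumes "F \<in> trop_rats"
  shows "(\<lambda>x. \<bar>F x\<bar>) \<in> trop_rats"
proof -
  have "(\<lambda>x. \<bar>F x\<bar>) = (\<lambda>x. max (F x) (- F x))"
    by (auto simp: fun_eq_iff)
  then show ?thesis using trop_rats_max[OF assms trop_rats_uminus[OF assms]] by simp
qed

lemma trop_rats_nat_mult:
  assumes "F \<in> trop_rats"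
  shows "(\<lambda>x. real m * F x) \<in> trop_rats"
proof (induction m)
  case 0
  then show ?case using trop_rats_const[of 0] by simp
next
  case (Suc m)
  then show ?case using trop_rats_add[OF assms Suc] by (simp add: algebra_simps)
qed

lemma trop_rats_Min:
  assumes "finite I" "I \<noteq> {}" "\<And>i. i \<in> I \<Longrightarrow> F i \<in> trop_rats"
  shows "(\<lambda>x. Min ((\<lambda>i. F i x) ` I)) \<in> trop_rats"
  using assms
proof (induction I rule: finite_ne_induct)
  case (singleton i)
  then show ?case by simp
next
  case (insert i I)
  then show ?case by (simp add: trop_rats_min)
qed

section \<open>Principal kernels\<close>

text \<open>Both weights are at most 0, which gives the upper bound; one of them equals 0, and its
  summand gives the lower bound. This makes domination stable under the convexity axiom of
  kernels.\<close>

lemma nuval_conv_comb_bound: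
  fixes \<alpha> \<beta> a b :: real
  assumes "max \<alpha> \<beta> = 0"
  shows "\<bar>max (\<alpha> + a) (\<beta> + b)\<bar> \<le> max \<bar>a\<bar> \<bar>b\<bar>"
  using assms by linarith

lemma nu_kernel_rational: "nu_kernel K \<Longrightarrow> a \<in> K \<Longrightarrow> a \<in> rational_funs"
  unfolding nu_kernel_def by blast

text \<open>This lemma and the next two restate the closure axioms through pointwise values, so that
  membership follows from real arithmetic.\<close>

lemma nu_kernel_mult:
  assumes "nu_kernel K" "a \<in> K" "b \<in> K" "c \<in> rational_funs"
    "\<And>x. nuval (c x) = nuval (a x) + nuval (b x)"
  shows "c \<in> K"
proof -
  have "c \<approx>\<^sub>\<nu> a * b" using assms(5) by (simp add: fun_nu_eq_iff fun_eq_iff)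
  then show ?thesis using assms(1-4) unfolding nu_kernel_def by blast
qed

lemma nu_kernel_star:
  assumes "nu_kernel K" "a \<in> K" "c \<in> rational_funs" "\<And>x. nuval (c x) = - nuval (a x)"
  shows "c \<in> K"
proof -
  have "c \<approx>\<^sub>\<nu> star \<circ> a" using assms(4) by (simp add: fun_nu_eq_iff fun_eq_iff)
  then show ?thesis using assms(1-3) unfolding nu_kernel_def by blast
qed

lemma nu_kernel_comb:
  assumes "nu_kernel K" "a \<in> K" "b \<in> K" "\<alpha> \<in> rational_funs" "\<beta> \<in> rational_funs"
    "c \<in> rational_funs" "\<And>x. max (nuval (\<alpha> x)) (nuval (\<beta> x)) = 0"
    "\<And>x. nuval (c x) = max (nuval (\<alpha> x) + nuval (a x)) (nuval (\<beta> x) + nuval (b x))"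
  shows "c \<in> K"
proof -
  have "\<alpha> + \<beta> \<approx>\<^sub>\<nu> 1" "c \<approx>\<^sub>\<nu> \<alpha> * a + \<beta> * b"
    using assms(7,8) by (simp_all add: fun_nu_eq_iff fun_eq_iff)
  then show ?thesis using assms(1-6) unfolding nu_kernel_def by blast
qed

text \<open>Take both weights equal to 1: the sum 1 + 1 is the ghost of 1, which is nu-equivalent to
  1.\<close>

lemma nu_kernel_max:
  assumes "nu_kernel K" "a \<in> K" "b \<in> K" "c \<in> rational_funs"
    "\<And>x. nuval (c x) = max (nuval (a x)) (nuval (b x))"
  shows "c \<in> K"
proof (rule nu_kernel_comb[OF assms(1-3) _ _ assms(4)])
  show "(\<lambda>x. 1) \<in> rational_funs" "(\<lambda>x. 1) \<in> rational_funs"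
    by (rule const_rational)+
qed (use assms(5) in auto)

text \<open>For \<open>a \<le> c \<le> b\<close> one has \<open>c = 1 \<cdot> a + (c b\<^sup>-\<^sup>1) \<cdot> b\<close> with \<open>1 + c b\<^sup>-\<^sup>1 = 1\<close>.\<close>

lemma nu_kernel_convex:
  assumes "nu_kernel K" "a \<in> K" "b \<in> K" "c \<in> rational_funs"
    "\<And>x. nuval (a x) \<le> nuval (c x)" "\<And>x. nuval (c x) \<le> nuval (b x)"
  shows "c \<in> K"
proof -
  have "b \<in> rational_funs" using assms nu_kernel_rational by blast
  then obtain \<beta> where \<beta>: "\<beta> \<in> rational_funs" "\<And>x. nuval (\<beta> x) = nuval (c x) - nuval (b x)"
    using trop_rational[OF trop_rats_diff[OF rational_trop rational_trop]] assms(4) by blast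
  show ?thesis
  proof (rule nu_kernel_comb[OF assms(1-3) const_rational \<beta>(1) assms(4), of 1])
    show "max (nuval 1) (nuval (\<beta> x)) = 0" for x
      using assms(6)[of x] by (simp add: \<beta> max_def)
    show "nuval (c x) = max (nuval 1 + nuval (a x)) (nuval (\<beta> x) + nuval (b x))" for x
      using assms(5)[of x] by (simp add: \<beta> max_def)
  qed
qed

text \<open>The absolute value is the maximum of f and its inverse, and multiples of values are
  powers of functions.\<close>

lemma nu_kernel_abs_mult:
  assumes "nu_kernel K" "f \<in> K" "r \<in> rational_funs" "\<And>x. nuval (r x) = real m * \<bar>nuval (f x)\<bar>"
  shows "r \<in> K"
proof -
  have f: "(\<lambda>x. nuval (f x)) \<in> trop_rats"
    by (rule rational_trop[OF nu_kernel_rational[OF assms(1,2)]])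
  obtain f' where f': "f' \<in> rational_funs" "\<And>x. nuval (f' x) = - nuval (f x)"
    using trop_rational[OF trop_rats_uminus[OF f]] by blast
  have f'K: "f' \<in> K" using nu_kernel_star[OF assms(1,2) f'] .
  obtain t where t: "t \<in> rational_funs" "\<And>x. nuval (t x) = \<bar>nuval (f x)\<bar>"
    using trop_rational[OF trop_rats_abs[OF f]] by blast
  have tK: "t \<in> K"
    by (rule nu_kernel_max[OF assms(1,2) f'K t(1)]) (auto simp: t f')
  show ?thesis
    using assms(3,4)
  proof (induction m arbitrary: r)
    \<comment> \<open>The value 0 is obtained as the product of f with its inverse.\<close>
    case 0
    show ?case by (rule nu_kernel_mult[OF assms(1,2) f'K 0(1)]) (simp add: 0 f')
  next
    case (Suc m)
    obtain s where s: "s \<in> rational_funs" "\<And>x. nuval (s x) = real m * \<bar>nuval (f x)\<bar>"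
      using trop_rational[OF trop_rats_nat_mult[OF trop_rats_abs[OF f]]] by blast
    show ?case
      by (rule nu_kernel_mult[OF assms(1) tK Suc.IH[OF s] Suc.prems(1)])
        (simp add: Suc.prems s t algebra_simps)
  qed
qed

text \<open>The explicit form of the kernel generated by f: the convex lattice-ordered subgroup
  generated by f, taken as a union of nu-classes.\<close>

definition dominated :: "'n::finite sfun \<Rightarrow> 'n sfun set" where
  "dominated f = {g \<in> rational_funs. \<exists>m::nat. \<forall>x. \<bar>nuval (g x)\<bar> \<le> real m * \<bar>nuval (f x)\<bar>}"

lemma dominated_kernel:
  assumes "f \<in> rational_funs"
  shows "nu_kernel (dominated f)"
  unfolding nu_kernel_def
proof (intro conjI ballI impI)
  show "dominated f \<subseteq> rational_funs" by (auto simp: dominated_def)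
  have "f \<in> dominated f"
    using assms by (auto simp: dominated_def intro!: exI[of _ "1::nat"])
  then show "dominated f \<noteq> {}" by auto
next
  fix a b c assume a: "a \<in> dominated f" and b: "b \<in> dominated f"
    and c: "c \<in> rational_funs" "c \<approx>\<^sub>\<nu> a * b"
  obtain m k :: nat where
    mk: "\<And>x. \<bar>nuval (a x)\<bar> \<le> real m * \<bar>nuval (f x)\<bar>" "\<And>x. \<bar>nuval (b x)\<bar> \<le> real k * \<bar>nuval (f x)\<bar>"
    using a b by (auto simp: dominated_def)
  have "\<bar>nuval (c x)\<bar> \<le> real (m + k) * \<bar>nuval (f x)\<bar>" for x
    using mk[of x] c(2) by (simp add: fun_nu_eq_iff fun_eq_iff algebra_simps)
  then show "c \<in> dominated f" using c unfolding dominated_def by blast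
next
  fix a c assume "a \<in> dominated f" and c: "c \<in> rational_funs" "c \<approx>\<^sub>\<nu> star \<circ> a"
  moreover have "\<bar>nuval (c x)\<bar> = \<bar>nuval (a x)\<bar>" for x
    using c(2) by (simp add: fun_nu_eq_iff fun_eq_iff)
  ultimately show "c \<in> dominated f" by (simp add: dominated_def)
next
  fix a b \<alpha> \<beta> c assume a: "a \<in> dominated f" and b: "b \<in> dominated f"
    and c: "c \<in> rational_funs" "c \<approx>\<^sub>\<nu> \<alpha> * a + \<beta> * b" and 1: "\<alpha> + \<beta> \<approx>\<^sub>\<nu> 1"
  obtain m k :: nat where
    mk: "\<And>x. \<bar>nuval (a x)\<bar> \<le> real m * \<bar>nuval (f x)\<bar>" "\<And>x. \<bar>nuval (b x)\<bar> \<le> real k * \<bar>nuval (f x)\<bar>"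
    using a b by (auto simp: dominated_def)
  have "\<bar>nuval (c x)\<bar> \<le> real (m + k) * \<bar>nuval (f x)\<bar>" for x
  proof -
    have "\<bar>nuval (c x)\<bar> \<le> max \<bar>nuval (a x)\<bar> \<bar>nuval (b x)\<bar>"
      using c(2) 1 by (simp add: fun_nu_eq_iff fun_eq_iff nuval_conv_comb_bound)
    also have "\<dots> \<le> real m * \<bar>nuval (f x)\<bar> + real k * \<bar>nuval (f x)\<bar>"
      using mk[of x] by linarith
    finally show ?thesis by (simp add: algebra_simps)
  qed
  then show "c \<in> dominated f" using c unfolding dominated_def by blast
qed

text \<open>For minimality, a kernel containing f contains the functions with values
  \<open>m * |f|\<close> and \<open>- m * |f|\<close>, hence by convexity every rational function
  between them.\<close>

lemma kernel_gen_singleton: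
  assumes "f \<in> rational_funs"
  shows "kernel_gen {f} = dominated f"
  unfolding kernel_gen_def
proof (rule hull_unique)
  show "{f} \<subseteq> dominated f"
    using assms by (auto simp: dominated_def intro!: exI[of _ "1::nat"])
  show "nu_kernel (dominated f)" using assms by (rule dominated_kernel)
next
  fix K assume f: "{f} \<subseteq> K" and K: "nu_kernel K"
  show "dominated f \<subseteq> K"
  proof
    fix g assume "g \<in> dominated f"
    then obtain m :: nat where
      g: "g \<in> rational_funs" and m: "\<And>x. \<bar>nuval (g x)\<bar> \<le> real m * \<bar>nuval (f x)\<bar>"
      by (auto simp: dominated_def)
    have F: "(\<lambda>x. real m * \<bar>nuval (f x)\<bar>) \<in> trop_rats"
      using assms by (intro trop_rats_nat_mult trop_rats_abs rational_trop)
    obtain b where b: "b \<in> rational_funs" "\<And>x. nuval (b x) = real m * \<bar>nuval (f x)\<bar>"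
      using trop_rational[OF F] by blast
    obtain a where a: "a \<in> rational_funs" "\<And>x. nuval (a x) = - (real m * \<bar>nuval (f x)\<bar>)"
      using trop_rational[OF trop_rats_uminus[OF F]] by blast
    have "b \<in> K" using nu_kernel_abs_mult[OF K _ b] f by simp
    moreover from this have "a \<in> K" using nu_kernel_star[OF K _ a(1)] a b by simp
    moreover have "nuval (a x) \<le> nuval (g x)" "nuval (g x) \<le> nuval (b x)" for x
      using m[of x] a b by (auto simp: abs_le_iff)
    ultimately show "g \<in> K" using nu_kernel_convex[OF K] g by blast
  qed
qed

text \<open>Domination is transitive, here obtained from minimality of the generated kernel.\<close>

lemma dominated_eqI:
  assumes "f \<in> rational_funs" "g \<in> rational_funs" "f \<in> dominated g" "g \<in> dominated f"
  shows "dominated f = dominated g"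
proof -
  have "dominated a \<subseteq> dominated b"
    if "a \<in> rational_funs" "b \<in> rational_funs" "a \<in> dominated b" for a b :: "'a sfun"
    using hull_minimal[of "{a}" "dominated b" nu_kernel] dominated_kernel[OF that(2)] that
    by (simp add: kernel_gen_singleton[OF that(1), unfolded kernel_gen_def])
  then show ?thesis using assms by blast
qed

text \<open>This is how containment in the kernel of constants enters: truncating the absolute value
  of a bounded function at a positive constant leaves its kernel unchanged.\<close>

lemma const_kernel_bounded:
  assumes "g \<in> const_kernel"
  obtains C where "\<And>x. \<bar>nuval (g x)\<bar> \<le> C"
proof -
  \<comment> \<open>\<open>Tangible 1\<close> is not the unit, which is \<open>Tangible 0\<close>.
    Its value 1 is positive, so by the Archimedean property its multiples dominate every
    constant.\<close>
  define e :: "'a sfun" where "e = (\<lambda>x. Tangible 1)"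
  have e: "e \<in> rational_funs" unfolding e_def by (rule const_rational)
  have "(\<lambda>x. c) \<in> dominated e" for c
    using real_arch_simple[of "\<bar>nuval c\<bar>"] const_rational by (auto simp: dominated_def e_def)
  then have "range (\<lambda>c x. c) \<subseteq> dominated e" by auto
  then have "const_kernel \<subseteq> dominated e"
    unfolding const_kernel_def kernel_gen_def by (rule hull_minimal) (rule dominated_kernel[OF e])
  with assms have "g \<in> dominated e" by blast
  then obtain m :: nat where "\<forall>x. \<bar>nuval (g x)\<bar> \<le> real m * \<bar>nuval (e x)\<bar>"
    unfolding dominated_def by blast
  then have "\<bar>nuval (g x)\<bar> \<le> real m" for x by (simp add: e_def)
  then show ?thesis by (rule that)
qed

section \<open>Wedge decompositions\<close>

text \<open>The last conclusion expresses that the infimum of the \<open>w i\<close> is at most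
  \<open>m * |f|\<close> at every point. The slack \<open>e\<close> is there because an infimum over
  an infinite family may not be attained.\<close>

lemma ex_generators_small_Inf:
  fixes f :: "'n::finite sfun" and v :: "'i \<Rightarrow> 'n sfun"
  assumes f: "f \<in> rational_funs" and "I \<noteq> {}"
    and v: "\<And>i. i \<in> I \<Longrightarrow> v i \<in> rational_funs"
    and bounded: "\<And>i. i \<in> I \<Longrightarrow> \<exists>C. \<forall>x. \<bar>nuval (v i x)\<bar> \<le> C"
    and inter: "dominated f = (\<Inter>i\<in>I. dominated (v i))"
  obtains w :: "'i \<Rightarrow> 'n sfun" and m :: nat
  where "\<And>i. i \<in> I \<Longrightarrow> w i \<in> rational_funs"
    "\<And>i x. i \<in> I \<Longrightarrow> 0 \<le> nuval (w i x)"
    "\<And>i. i \<in> I \<Longrightarrow> dominated (w i) = dominated (v i)"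
    "\<And>x e. 0 < e \<Longrightarrow> \<exists>i\<in>I. nuval (w i x) < real m * \<bar>nuval (f x)\<bar> + e"
proof (cases "finite I")
  case True
  have abs_v: "(\<lambda>x. \<bar>nuval (v i x)\<bar>) \<in> trop_rats" if "i \<in> I" for i
    using v[OF that] by (intro trop_rats_abs rational_trop)
  obtain w where w: "\<And>i. i \<in> I \<Longrightarrow> w i \<in> rational_funs"
    "\<And>i x. i \<in> I \<Longrightarrow> nuval (w i x) = \<bar>nuval (v i x)\<bar>"
    using trop_rational_family[where F = "\<lambda>i x. \<bar>nuval (v i x)\<bar>", OF abs_v] by blast
  \<comment> \<open>The minimum of finitely many rational functions is again rational. It is
    dominated by every \<open>v i\<close>, so it lies in the intersection, and \<open>inter\<close>
    then supplies \<open>m\<close>.\<close>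
  obtain h where h: "h \<in> rational_funs" "\<And>x. nuval (h x) = Min ((\<lambda>i. \<bar>nuval (v i x)\<bar>) ` I)"
    using trop_rational[OF trop_rats_Min[where F = "\<lambda>i x. \<bar>nuval (v i x)\<bar>",
        OF True \<open>I \<noteq> {}\<close> abs_v]] by blast
  have "h \<in> dominated (v i)" if "i \<in> I" for i
  proof -
    have "\<bar>nuval (h x)\<bar> \<le> real 1 * \<bar>nuval (v i x)\<bar>" for x
    proof -
      have "nuval (h x) \<le> \<bar>nuval (v i x)\<bar>" "0 \<le> nuval (h x)"
        using True that \<open>I \<noteq> {}\<close> by (auto simp: h)
      then show ?thesis by simp
    qed
    then show ?thesis using h unfolding dominated_def by blast
  qed
  then have "h \<in> dominated f" using inter by auto
  then obtain m :: nat where m: "\<And>x. \<bar>nuval (h x)\<bar> \<le> real m * \<bar>nuval (f x)\<bar>"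
    by (auto simp: dominated_def)
  have "\<exists>i\<in>I. nuval (w i x) < real m * \<bar>nuval (f x)\<bar> + e" if "0 < e" for x e
  proof -
    have "Min ((\<lambda>i. \<bar>nuval (v i x)\<bar>) ` I) \<in> (\<lambda>i. \<bar>nuval (v i x)\<bar>) ` I"
      using True \<open>I \<noteq> {}\<close> by (intro Min_in) auto
    then obtain i where "i \<in> I" "nuval (h x) = \<bar>nuval (v i x)\<bar>"
      by (auto simp: h)
    then show ?thesis using m[of x] w that by (intro bexI[of _ i]) auto
  qed
  moreover have "dominated (w i) = dominated (v i)" if "i \<in> I" for i
    using w(2)[OF that] by (simp add: dominated_def)
  ultimately show ?thesis using that[of w m] w by auto
next
  case False
  obtain g :: "nat \<Rightarrow> 'i" where g: "inj g" "range g \<subseteq> I"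
    using infinite_countable_subset[OF False] by blast
  \<comment> \<open>Along the injected sequence \<open>g n\<close> these constants are 1/(n+1) and
    tend to 0. Outside the range of \<open>g\<close> the natural number \<open>inv g i\<close> is
    unspecified, but \<open>e i\<close> is still positive.\<close>
  define e where "e i = 1 / (real (inv g i) + 1)" for i
  have e_pos: "e i > 0" for i by (simp add: e_def add_nonneg_pos)
  have "(\<lambda>x. min \<bar>nuval (v i x)\<bar> (e i)) \<in> trop_rats" if "i \<in> I" for i
    using v[OF that] by (intro trop_rats_abs rational_trop trop_rats_min trop_rats_const)
  then obtain w where w: "\<And>i. i \<in> I \<Longrightarrow> w i \<in> rational_funs"
    "\<And>i x. i \<in> I \<Longrightarrow> nuval (w i x) = min \<bar>nuval (v i x)\<bar> (e i)"
    using trop_rational_family[where F = "\<lambda>i x. min \<bar>nuval (v i x)\<bar> (e i)"] by blast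
  have w_nonneg: "0 \<le> nuval (w i x)" if "i \<in> I" for i x
    using w(2)[OF that] e_pos[of i] by simp
  have "dominated (w i) = dominated (v i)" if i: "i \<in> I" for i
  proof (rule dominated_eqI)
    show "w i \<in> rational_funs" "v i \<in> rational_funs" using w v i by auto
    have "\<bar>nuval (w i x)\<bar> \<le> real 1 * \<bar>nuval (v i x)\<bar>" for x
      using w_nonneg[OF i, of x] w(2)[OF i] by simp
    then show "w i \<in> dominated (v i)" using w i unfolding dominated_def by blast
    obtain C where C: "\<And>x. \<bar>nuval (v i x)\<bar> \<le> C" using bounded[OF i] by blast
    obtain k :: nat where k: "C < real k * e i"
      using reals_Archimedean3[OF e_pos] by blast
    \<comment> \<open>Where \<open>w i\<close> equals the absolute value of \<open>v i\<close>, a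
      factor of at least 1 is enough, which \<open>Suc k\<close> guarantees. Elsewhere
      \<open>w i\<close> is the constant \<open>e i\<close>, and the bound \<open>C\<close> lies
      below \<open>k * e i\<close>.\<close>
    have "\<bar>nuval (v i x)\<bar> \<le> real (Suc k) * \<bar>nuval (w i x)\<bar>" for x
    proof (cases "\<bar>nuval (v i x)\<bar> \<le> e i")
      case True
      then have "\<bar>nuval (w i x)\<bar> = \<bar>nuval (v i x)\<bar>" using w(2)[OF i] by simp
      then show ?thesis by (simp add: algebra_simps)
    next
      case False
      then have "\<bar>nuval (w i x)\<bar> = e i" using w(2)[OF i] e_pos[of i] by simp
      then show ?thesis using C[of x] k e_pos[of i] by (simp add: algebra_simps)
    qed
    then show "v i \<in> dominated (w i)" using v i unfolding dominated_def by blast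
  qed
  \<comment> \<open>The cutoffs alone force the infimum to be 0, so \<open>m = 0\<close>
    works.\<close>
  moreover have "\<exists>i\<in>I. nuval (w i x) < real 0 * \<bar>nuval (f x)\<bar> + d" if "0 < d" for x d
  proof -
    obtain n :: nat where "inverse (real (Suc n)) < d"
      using reals_Archimedean[OF \<open>0 < d\<close>] by blast
    then have n: "1 / (real n + 1) < d"
      by (simp add: inverse_eq_divide add.commute)
    have "g n \<in> I" "e (g n) = 1 / (real n + 1)" using g by (auto simp: e_def inv_f_f)
    then show ?thesis using w n by (intro bexI[of _ "g n"]) (auto simp: min_less_iff_disj)
  qed
  ultimately show ?thesis using that[of w 0] w w_nonneg by blast
qed

theorem theorem8p5p3:
  fixes f :: "'n::finite sfun" and I :: "'i set" and K :: "'i \<Rightarrow> 'n sfun set"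
  assumes "f \<in> rational_funs"
    and "I \<noteq> {}"
    and "\<And>i. i \<in> I \<Longrightarrow> nu_subkernel (K i) const_kernel"
    and "\<And>i. i \<in> I \<Longrightarrow> principal_kernel (K i)"
    and "kernel_gen {f} = (\<Inter>i\<in>I. K i)"
  shows "\<exists>u. wedge_decomposition f I u \<and> associated_decomposition I K u"
proof -
  obtain v where v: "\<And>i. i \<in> I \<Longrightarrow> v i \<in> rational_funs \<and> K i = kernel_gen {v i}"
    using assms(4) unfolding principal_kernel_def by metis
  have K: "K i = dominated (v i)" if "i \<in> I" for i
    using v[OF that] by (simp add: kernel_gen_singleton)
  have inter: "dominated f = (\<Inter>i\<in>I. dominated (v i))"
    using assms(5) K kernel_gen_singleton[OF assms(1)] by auto
  have v_gen: "v i \<in> K i" if "i \<in> I" for i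
    using v[OF that] by (simp add: kernel_gen_def hull_inc)
  have bounded: "\<exists>C. \<forall>x. \<bar>nuval (v i x)\<bar> \<le> C" if "i \<in> I" for i
    using v_gen[OF that] assms(3)[OF that] const_kernel_bounded
    unfolding nu_subkernel_def by (metis subsetD)
  obtain w :: "'i \<Rightarrow> 'n sfun" and m :: nat
    where w: "\<And>i. i \<in> I \<Longrightarrow> w i \<in> rational_funs"
    and w_nonneg: "\<And>i x. i \<in> I \<Longrightarrow> 0 \<le> nuval (w i x)"
    and w_gen: "\<And>i. i \<in> I \<Longrightarrow> dominated (w i) = dominated (v i)"
    and w_small: "\<And>x e. 0 < e \<Longrightarrow> \<exists>i\<in>I. nuval (w i x) < real m * \<bar>nuval (f x)\<bar> + e"
    using ex_generators_small_Inf[OF assms(1,2) _ bounded inter] v by blast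
  have abs_f: "(\<lambda>x. \<bar>nuval (f x)\<bar>) \<in> trop_rats"
    using assms(1) by (intro trop_rats_abs rational_trop)
  \<comment> \<open>The added excess of \<open>w i\<close> over \<open>m * |f|\<close> is
    nonnegative, so the sum never drops below \<open>|f|\<close>; where \<open>w i\<close> is close
    to or below \<open>m * |f|\<close>, the excess is small.\<close>
  have "(\<lambda>x. \<bar>nuval (f x)\<bar> + max 0 (nuval (w i x) - real m * \<bar>nuval (f x)\<bar>)) \<in> trop_rats"
    if "i \<in> I" for i
    using w[OF that] abs_f
    by (intro trop_rats_add trop_rats_max trop_rats_const trop_rats_diff rational_trop
        trop_rats_nat_mult)
  then obtain u where u_rat: "\<And>i. i \<in> I \<Longrightarrow> u i \<in> rational_funs" and
    u: "\<And>i x. i \<in> I \<Longrightarrow>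
      nuval (u i x) = \<bar>nuval (f x)\<bar> + max 0 (nuval (w i x) - real m * \<bar>nuval (f x)\<bar>)"
    using trop_rational_family[where
        F = "\<lambda>i x. \<bar>nuval (f x)\<bar> + max 0 (nuval (w i x) - real m * \<bar>nuval (f x)\<bar>)"]
    by blast
  have "kernel_gen {u i} = K i" if i: "i \<in> I" for i
  proof -
    have "f \<in> dominated f"
      using assms(1) by (auto simp: dominated_def intro!: exI[of _ "1::nat"])
    then have "f \<in> dominated (w i)" using inter w_gen i by auto
    then obtain k :: nat where k: "\<And>x. \<bar>nuval (f x)\<bar> \<le> real k * \<bar>nuval (w i x)\<bar>"
      by (auto simp: dominated_def)
    \<comment> \<open>The excess is at most \<open>w i\<close>, and f, lying in the intersection, is
      at most \<open>k * w i\<close> in absolute value.\<close>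
    have "\<bar>nuval (u i x)\<bar> \<le> real (Suc k) * \<bar>nuval (w i x)\<bar>" for x
    proof -
      have "0 \<le> real m * \<bar>nuval (f x)\<bar>" by simp
      then have "\<bar>nuval (u i x)\<bar> \<le> \<bar>nuval (f x)\<bar> + \<bar>nuval (w i x)\<bar>"
        using u[OF i] w_nonneg[OF i, of x] by simp
      then show ?thesis using k[of x] by (simp add: algebra_simps)
    qed
    then have "u i \<in> dominated (w i)" using u_rat i unfolding dominated_def by blast
    \<comment> \<open>Conversely \<open>w i\<close> is at most \<open>m * |f|\<close> plus the
      excess, and both \<open>|f|\<close> and the excess are bounded by \<open>u i\<close>.\<close>
    moreover have "\<bar>nuval (w i x)\<bar> \<le> real (Suc m) * \<bar>nuval (u i x)\<bar>" for x
    proof -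
      have "real m * \<bar>nuval (f x)\<bar> \<le> real m * \<bar>nuval (u i x)\<bar>"
        using u[OF i] by (intro mult_left_mono) auto
      moreover have "nuval (w i x) \<le> real m * \<bar>nuval (f x)\<bar> + \<bar>nuval (u i x)\<bar>"
        using u[OF i] by simp
      ultimately show ?thesis using w_nonneg[OF i, of x] by (simp add: algebra_simps)
    qed
    then have "w i \<in> dominated (u i)" using w i unfolding dominated_def by blast
    ultimately have "dominated (u i) = dominated (w i)" using u_rat w i by (intro dominated_eqI) auto
    then show ?thesis using u_rat i K w_gen by (simp add: kernel_gen_singleton)
  qed
  moreover have "is_wedge (sabs (f x)) I (\<lambda>i. sabs (u i x))" for x
    unfolding is_wedge_def nu_le_def
  proof (intro conjI ballI allI impI)
    show "nuval (sabs (f x)) \<le> nuval (sabs (u i x))" if "i \<in> I" for i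
      using u[OF that] by simp
  next
    fix b assume b: "\<forall>i\<in>I. nuval b \<le> nuval (sabs (u i x))"
    show "nuval b \<le> nuval (sabs (f x))"
    \<comment> \<open>If b exceeded \<open>|f|\<close> at x by some d > 0, then
      \<open>w_small\<close> with slack d would give an index, depending on x, at which the excess
      is below d, so that \<open>u i\<close> is below b.\<close>
    proof (rule ccontr)
      assume "\<not> ?thesis"
      then have d: "0 < nuval b - \<bar>nuval (f x)\<bar>" by simp
      then obtain i where i: "i \<in> I"
        "nuval (w i x) < real m * \<bar>nuval (f x)\<bar> + (nuval b - \<bar>nuval (f x)\<bar>)"
        using w_small by blast
      then have "\<bar>nuval (u i x)\<bar> < nuval b" using u[OF i(1)] d by simp
      then show False using b i(1) by force
    qed
  qed
  ultimately show ?thesis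
    using u_rat unfolding wedge_decomposition_def associated_decomposition_def by blast
qed

end
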